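(* Let $K$ be a field of characteristic zero, let $\Phi(t)\in K[t]$ be an arbitrary polynomial, and let $\Lambda=(\partial_x-\Phi(\partial_y))\partial_y$, regarded as a differential operator on $K[x,y]$. Let $P(x,y)\in K[x,y]$ be any polynomial such that $\Lambda^m(P^m)=0$ for all integers $m\geq 1$. Then for every polynomial $Q(x,y)\in K[x,y]$ there exists an integer $N$ such that $\Lambda^m(P^mQ)=0$ for all integers $m\geq N$.
   Context: Here $\partial_x=\partial/\partial x$ and $\partial_y=\partial/\partial y$ are the partial derivatives on the polynomial ring $K[x,y]$. For $\Phi(t)=q_0+q_1t+\cdots+q_st^s$ with $q_i\in K$, the operator $\Phi(\partial_y)$ is $q_0+q_1\partial_y+\cdots+q_s\partial_y^s$, where $q_0$ acts as multiplication by the scalar $q_0$. $\Lambda^m$ denotes the $m$-fold composition of $\Lambda$ with itself, and $P^m$ denotes the $m$-th power of the polynomial $P$. *)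

theory Defs
  imports "HOL-Computational_Algebra.Polynomial"
begin

text \<open>
  The ring \<open>K[x,y]\<close> is represented as \<open>K[x][y]\<close>, that is, as the type \<open>'a poly poly\<close>: the outer
  variable is \<open>y\<close> and the coefficients are polynomials in \<open>x\<close>, so the monomial \<open>c x^i y^j\<close> is
  \<open>monom (monom c i) j\<close>.  Hence \<open>\<partial>\<^sub>y\<close> is the formal derivative of the outer polynomial, and \<open>\<partial>\<^sub>x\<close>
  applies the formal derivative to every coefficient.
\<close>

definition dx :: "'a::field_char_0 poly poly \<Rightarrow> 'a poly poly" where
  "dx f = map_poly pderiv f"

definition dy :: "'a::field_char_0 poly poly \<Rightarrow> 'a poly poly" where
  "dy f = pderiv f"

text \<open>A scalar \<open>q\<close> of \<open>K\<close> acts on \<open>K[x][y]\<close> as multiplication by the constant \<open>[:q:]\<close> of \<open>K[x]\<close>.\<close>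

definition Phi_dy :: "'a::field_char_0 poly \<Rightarrow> 'a poly poly \<Rightarrow> 'a poly poly" where
  "Phi_dy \<Phi> f = (\<Sum>i\<le>degree \<Phi>. smult [:coeff \<Phi> i:] ((dy ^^ i) f))"

definition Lam :: "'a::field_char_0 poly \<Rightarrow> 'a poly poly \<Rightarrow> 'a poly poly" where
  "Lam \<Phi> f = dx (dy f) - Phi_dy \<Phi> (dy f)"

lemma dx_monom: "dx (monom (monom c i) j) = monom (monom (of_nat i * c) (i - 1)) j"
  by (simp add: dx_def map_poly_monom pderiv_monom)

lemma dy_monom: "dy (monom (monom c i) j) = monom (monom (of_nat j * c) i) (j - 1)"
  by (simp add: dy_def pderiv_monom of_nat_poly smult_monom)

end

theory Submission
  imports Defs
begin

text \<open>
  Write \<open>\<Phi> = q\<^sub>0 + q\<^sub>1 t + \<dots>\<close>.  The proof studies the Newton polygon of \<open>P\<close>.  If some weight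
  \<open>A i + B j\<close> of the monomials \<open>x\<^sup>i y\<^sup>j\<close> is less than \<open>A + B\<close> on all of \<open>P\<close>, and every term of \<open>\<Lambda>\<close>
  lowers this weight by at least \<open>A + B\<close>, then \<open>\<Lambda>\<^sup>m\<close> removes more weight than \<open>P\<^sup>m Q\<close> has as soon as \<open>m\<close> is
  large (\<open>vanishing_of_weight_less\<close>).  So it suffices to derive the existence of such a weight from
  \<open>\<Lambda>\<^sup>m(P\<^sup>m) = 0\<close>.

  The shear \<open>y \<mapsto> y + q\<^sub>1 x\<close> removes the linear term of \<open>\<Phi>\<close>.  If \<open>q\<^sub>0 \<noteq> 0\<close>, then \<open>\<Lambda> P = 0\<close> alone forces \<open>P\<close>
  to be free of \<open>y\<close>.  So let \<open>t\<^sup>r\<close> with \<open>r \<ge> 2\<close> be the lowest power in \<open>\<Phi>\<close>, and let \<open>d > 0\<close> be the degree of \<open>P\<close>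
  in \<open>y\<close> (for \<open>\<Phi> = 0\<close>, any \<open>r \<ge> d\<close> will do).  From \<open>\<Lambda> P = 0\<close> the coefficient of \<open>y\<^sup>d\<close> is
  constant, so \<open>y\<^sup>d\<close> is a vertex of the polygon.  The edge leaving it to the right has some slope, and there are two cases.

  If the slope is less than \<open>r\<close>, the operator induced on the edge is \<open>\<partial>\<^sub>x\<partial>\<^sub>y\<close>.  The other vertex must then
  be a power \<open>x\<^sup>n\<close>, and the powers of the edge polynomial \<open>p\<close>, in one variable, have vanishing
  coefficients on an interval of length proportional to \<open>m (n d - n - d)\<close>.  The
  differential equation \<open>p h' = m p' h\<close> of \<open>h = p\<^sup>m\<close> yields a recurrence of order \<open>deg p\<close> for its
  coefficients, so a long gap would propagate to the leading coefficient.  Hence \<open>n d < n + d\<close>, which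
  gives the weight (\<open>polynomial_power_gap\<close>, \<open>weight_le_of_shallow_edge\<close>).

  Otherwise \<open>P\<close> lies on or below the line \<open>r i + j = d\<close>.  If \<open>d \<le> r\<close>, this is the weight.  If \<open>d > r\<close>, the
  operator \<open>(\<partial>\<^sub>x - q\<^sub>r \<partial>\<^sub>y\<^sup>r) \<partial>\<^sub>y\<close> induced on the line acts as a finite difference on suitably scaled
  coefficients.  Its \<open>m\<close>-th power kills the scaled coefficients of \<open>p\<^sup>m\<close>, which are therefore given by a
  polynomial in the index.  Substituted into the same recurrence, this gives a nonzero polynomial
  with more roots than its degree, except for \<open>d = r + 1\<close>, where \<open>m = 1\<close> and \<open>m = 2\<close> contradict each other
  (\<open>power_coeffs_not_factorial_like\<close>, \<open>no_critical_edge\<close>).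
\<close>

section \<open>Coefficients, weights and edges\<close>

text \<open>
  These are the coefficients with respect to the divided monomials \<open>x\<^sup>i y\<^sup>j / (i! j!)\<close>.  In this basis
  \<open>\<partial>\<^sub>x\<close> and \<open>\<partial>\<^sub>y\<close> are index shifts, so a constant coefficient operator acts on the array of
  coefficients without any factorials.
\<close>
definition dcoeff :: "'a::field_char_0 poly poly \<Rightarrow> nat \<Rightarrow> nat \<Rightarrow> 'a" where
  "dcoeff f i j = fact i * fact j * coeff (coeff f j) i"

definition weight_le :: "nat \<Rightarrow> nat \<Rightarrow> nat \<Rightarrow> 'a::field_char_0 poly poly \<Rightarrow> bool" where
  "weight_le A B M f \<longleftrightarrow> (\<forall>i j. coeff (coeff f j) i \<noteq> 0 \<longrightarrow> A * i + B * j \<le> M)"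

lemma dcoeff_eq_0_iff: "dcoeff f i j = 0 \<longleftrightarrow> coeff (coeff f j) i = 0"
  by (simp add: dcoeff_def)

lemma dcoeff_zero [simp]: "dcoeff 0 i j = 0"
  by (simp add: dcoeff_def)

lemma dcoeff_dy: "dcoeff (dy f) i j = dcoeff f i (Suc j)"
proof -
  have "coeff (coeff (dy f) j) i = of_nat (Suc j) * coeff (coeff f (Suc j)) i"
    by (simp add: dy_def coeff_pderiv of_nat_poly del: of_nat_Suc)
  then show ?thesis
    by (simp add: dcoeff_def algebra_simps)
qed

lemma dcoeff_dx: "dcoeff (dx f) i j = dcoeff f (Suc i) j"
  by (simp add: dcoeff_def dx_def coeff_map_poly coeff_pderiv algebra_simps)

lemma dcoeff_dy_funpow: "dcoeff ((dy ^^ l) f) i j = dcoeff f i (j + l)"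
  by (induction l arbitrary: j) (simp_all add: dcoeff_dy)

lemma dcoeff_Phi_dy:
  "dcoeff (Phi_dy \<Phi> f) i j = (\<Sum>l\<le>degree \<Phi>. coeff \<Phi> l * dcoeff f i (j + l))"
proof -
  have "dcoeff (Phi_dy \<Phi> f) i j = (\<Sum>l\<le>degree \<Phi>. coeff \<Phi> l * dcoeff ((dy ^^ l) f) i j)"
    by (simp add: Phi_dy_def dcoeff_def coeff_sum sum_distrib_left algebra_simps)
  then show ?thesis by (simp add: dcoeff_dy_funpow)
qed

lemma dcoeff_Lam:
  "dcoeff (Lam \<Phi> f) i j =
     dcoeff f (Suc i) (Suc j) - (\<Sum>l\<le>degree \<Phi>. coeff \<Phi> l * dcoeff f i (Suc (j + l)))"
proof -
  have "dcoeff (Lam \<Phi> f) i j = dcoeff (dx (dy f)) i j - dcoeff (Phi_dy \<Phi> (dy f)) i j"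
    by (simp add: Lam_def dcoeff_def algebra_simps)
  then show ?thesis by (simp add: dcoeff_dx dcoeff_dy dcoeff_Phi_dy)
qed

lemma weight_le_dcoeff: "weight_le A B M f \<longleftrightarrow> (\<forall>i j. dcoeff f i j \<noteq> 0 \<longrightarrow> A * i + B * j \<le> M)"
  by (simp add: weight_le_def dcoeff_eq_0_iff)

text \<open>
  The operator \<open>\<partial>\<^sub>x\<partial>\<^sub>y\<close> lowers the weight \<open>A i + B j\<close> by exactly \<open>A + B\<close>, and the hypothesis on \<open>\<Phi>\<close> says
  that no other term \<open>\<partial>\<^sub>y\<^bsup>l+1\<^esup>\<close> of \<open>\<Lambda>\<close> lowers it by less.
\<close>
lemma weight_drop_Lam:
  assumes f: "weight_le A B M f" and \<Phi>: "\<forall>l. coeff \<Phi> l \<noteq> 0 \<longrightarrow> A \<le> l * B"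
    and nz: "dcoeff (Lam \<Phi> f) i j \<noteq> 0"
  shows "A * i + B * j + (A + B) \<le> M"
proof (cases "dcoeff f (Suc i) (Suc j) = 0")
  case False
  then show ?thesis using f unfolding weight_le_dcoeff by fastforce
next
  case True
  then have "(\<Sum>l\<le>degree \<Phi>. coeff \<Phi> l * dcoeff f i (Suc (j + l))) \<noteq> 0"
    using nz by (simp add: dcoeff_Lam)
  then obtain l where l: "coeff \<Phi> l * dcoeff f i (Suc (j + l)) \<noteq> 0"
    by (meson sum.not_neutral_contains_not_neutral)
  then have "A * i + B * Suc (j + l) \<le> M" "A \<le> l * B"
    using f \<Phi> unfolding weight_le_dcoeff by fastforce+
  then show ?thesis by (simp add: algebra_simps)
qed

lemma weight_drop_Lam_funpow:
  assumes f: "weight_le A B M f" and \<Phi>: "\<forall>l. coeff \<Phi> l \<noteq> 0 \<longrightarrow> A \<le> l * B"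
    and nz: "dcoeff ((Lam \<Phi> ^^ m) f) i j \<noteq> 0"
  shows "A * i + B * j + m * (A + B) \<le> M"
  using nz
proof (induction m arbitrary: i j)
  case 0
  then show ?case using f by (simp add: weight_le_dcoeff)
next
  case (Suc m)
  have m: "A * i + B * j + m * (A + B) \<le> M" if "dcoeff ((Lam \<Phi> ^^ m) f) i j \<noteq> 0" for i j
    using Suc.IH that .
  have "(Lam \<Phi> ^^ m) f \<noteq> 0"
    using Suc.prems by (auto simp: dcoeff_Lam)
  then obtain i' j' where "dcoeff ((Lam \<Phi> ^^ m) f) i' j' \<noteq> 0"
    by (metis dcoeff_eq_0_iff leading_coeff_neq_0)
  \<comment> \<open>Needed because \<open>M - m (A + B)\<close> below is a truncated difference.\<close>
  then have le: "m * (A + B) \<le> M" using m by fastforce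
  have "weight_le A B (M - m * (A + B)) ((Lam \<Phi> ^^ m) f)"
    unfolding weight_le_dcoeff using m le by fastforce
  from weight_drop_Lam[OF this \<Phi>, of i j] Suc.prems
  have "A * i + B * j + (A + B) \<le> M - m * (A + B)" by simp
  then show ?case using le by simp
qed

lemma coeff_coeff_mult:
  fixes f g :: "'a::field_char_0 poly poly"
  shows "coeff (coeff (f * g) j) i =
    (\<Sum>i'\<le>i. \<Sum>j'\<le>j. coeff (coeff f j') i' * coeff (coeff g (j - j')) (i - i'))"
  by (simp add: coeff_mult coeff_sum sum.swap[of _ "{..i}"])

lemma weight_le_mult:
  assumes f: "weight_le A B M f" and g: "weight_le A B N g"
  shows "weight_le A B (M + N) (f * g)"
  unfolding weight_le_def
proof (intro allI impI)
  fix i j assume "coeff (coeff (f * g) j) i \<noteq> 0"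
  then obtain i' j' where ij: "i' \<le> i" "j' \<le> j"
    and nz: "coeff (coeff f j') i' * coeff (coeff g (j - j')) (i - i') \<noteq> 0"
    unfolding coeff_coeff_mult by (meson atMost_iff sum.not_neutral_contains_not_neutral)
  have "A * i' + B * j' \<le> M" "A * (i - i') + B * (j - j') \<le> N"
    using f g nz unfolding weight_le_def by auto
  then have "A * (i' + (i - i')) + B * (j' + (j - j')) \<le> M + N"
    by (simp only: distrib_left)
  then show "A * i + B * j \<le> M + N" using ij by simp
qed

lemma weight_le_power: "weight_le A B M f \<Longrightarrow> weight_le A B (m * M) (f ^ m)"
proof (induction m)
  case 0
  then show ?case by (auto simp: weight_le_def coeff_1 split: if_splits)
next
  case (Suc m)
  then show ?case using weight_le_mult[of A B M f "m * M" "f ^ m"] by simp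
qed

lemma ex_weight_le: "\<exists>C. weight_le A B C f"
proof -
  define C where "C = (\<Sum>j\<le>degree f. A * degree (coeff f j) + B * j)"
  have "weight_le A B C f"
    unfolding weight_le_def
  proof (intro allI impI)
    fix i j assume nz: "coeff (coeff f j) i \<noteq> 0"
    then have j: "j \<le> degree f" by (intro le_degree) auto
    have "i \<le> degree (coeff f j)" using nz by (rule le_degree)
    then have "A * i + B * j \<le> A * degree (coeff f j) + B * j" by simp
    also have "\<dots> \<le> C" unfolding C_def using j
      by (intro member_le_sum[of j "{..degree f}" "\<lambda>j. A * degree (coeff f j) + B * j"]) auto
    finally show "A * i + B * j \<le> C" .
  qed
  then show ?thesis ..
qed

text \<open>
  Every conclusion about products \<open>P\<^sup>m Q\<close> comes from this count: the factor \<open>P\<^sup>m\<close> contributes weight at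
  most \<open>m M\<close>, the \<open>m\<close> operators remove \<open>m (A + B)\<close>, and the fixed contribution of \<open>Q\<close> cannot make up for
  the difference once \<open>m\<close> is large.
\<close>
lemma vanishing_of_weight_less:
  assumes P: "weight_le A B M P" and M: "M < A + B"
    and \<Phi>: "\<forall>l. coeff \<Phi> l \<noteq> 0 \<longrightarrow> A \<le> l * B"
  shows "\<exists>N. \<forall>m\<ge>N. (Lam \<Phi> ^^ m) (P ^ m * Q) = 0"
proof -
  obtain C where C: "weight_le A B C Q" using ex_weight_le by blast
  have "(Lam \<Phi> ^^ m) (P ^ m * Q) = 0" if m: "m \<ge> Suc C" for m
  proof (rule ccontr)
    assume "(Lam \<Phi> ^^ m) (P ^ m * Q) \<noteq> 0"
    then obtain i j where nz: "dcoeff ((Lam \<Phi> ^^ m) (P ^ m * Q)) i j \<noteq> 0"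
      by (metis dcoeff_eq_0_iff leading_coeff_neq_0)
    have "weight_le A B (m * M + C) (P ^ m * Q)"
      by (intro weight_le_mult weight_le_power P C)
    from weight_drop_Lam_funpow[OF this \<Phi> nz] have "m * (A + B) \<le> m * M + C" by simp
    moreover have "m * (A + B) \<ge> m * M + m"
      using mult_le_mono2[of "Suc M" "A + B" m] M by simp
    ultimately show False using m by simp
  qed
  then show ?thesis by blast
qed

text \<open>
  The part of weight exactly \<open>M\<close>, with \<open>y\<close> set to \<open>1\<close>.  For \<open>B > 0\<close> the exponent of \<open>x\<close> on the line
  \<open>A i + B j = M\<close> determines that of \<open>y\<close>, so nothing is lost, and the edges of the Newton polygon become
  polynomials in one variable.
\<close>
definition edge_poly :: "nat \<Rightarrow> nat \<Rightarrow> nat \<Rightarrow> 'a::field_char_0 poly poly \<Rightarrow> 'a poly" where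
  "edge_poly A B M f =
     (\<Sum>j\<le>degree f. \<Sum>i\<le>degree (coeff f j).
        if A * i + B * j = M then monom (coeff (coeff f j) i) i else 0)"

lemma coeff_edge_poly_aux:
  "coeff (edge_poly A B M f) i = (\<Sum>j\<le>degree f. if A * i + B * j = M then coeff (coeff f j) i else 0)"
proof -
  have "coeff (edge_poly A B M f) i =
    (\<Sum>j\<le>degree f. \<Sum>i'\<le>degree (coeff f j).
        if i' = i then (if A * i + B * j = M then coeff (coeff f j) i else 0) else 0)"
    unfolding edge_poly_def coeff_sum by (intro sum.cong refl) (simp add: coeff_monom)
  also have "\<dots> = (\<Sum>j\<le>degree f. if A * i + B * j = M then coeff (coeff f j) i else 0)"
    by (intro sum.cong) (auto simp: sum.delta coeff_eq_0)
  finally show ?thesis .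
qed

lemma coeff_edge_poly:
  assumes B: "B > 0" and eq: "A * i + B * j = M"
  shows "coeff (edge_poly A B M f) i = coeff (coeff f j) i"
proof -
  have "(A * i + B * j' = M) = (j' = j)" for j'
    using B eq by (metis add_left_cancel mult_left_cancel not_gr_zero)
  then show ?thesis
    by (auto simp: coeff_edge_poly_aux sum.delta coeff_eq_0)
qed

lemma coeff_edge_poly_nz:
  assumes "coeff (edge_poly A B M f) i \<noteq> 0"
  obtains j where "A * i + B * j = M"
proof -
  obtain j where "(if A * i + B * j = M then coeff (coeff f j) i else 0) \<noteq> 0"
    using assms unfolding coeff_edge_poly_aux by (blast elim: sum.not_neutral_contains_not_neutral)
  then show thesis using that by (metis (full_types))
qed

text \<open>
  Monomials of extremal weight in the product arise only from monomials of extremal weight in both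
  factors.
\<close>
lemma edge_poly_mult:
  assumes B: "B > 0" and f: "weight_le A B M f" and g: "weight_le A B N g"
  shows "edge_poly A B (M + N) (f * g) = edge_poly A B M f * edge_poly A B N g"
proof (rule poly_eqI)
  fix i
  show "coeff (edge_poly A B (M + N) (f * g)) i = coeff (edge_poly A B M f * edge_poly A B N g) i"
  proof (cases "\<exists>j. A * i + B * j = M + N")
    case True
    then obtain j where j: "A * i + B * j = M + N" by blast
    have "(\<Sum>j'\<le>j. coeff (coeff f j') i' * coeff (coeff g (j - j')) (i - i')) =
          coeff (edge_poly A B M f) i' * coeff (edge_poly A B N g) (i - i')" if i': "i' \<le> i" for i'
    proof -
      have i_eq: "A * i = A * i' + A * (i - i')"
        using i' by (simp flip: distrib_left)
      have j_eq: "B * j = B * j' + B * (j - j')" if "j' \<le> j" for j'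
        using that by (simp flip: distrib_left)
      have edge: "A * i' + B * j' = M \<and> A * (i - i') + B * (j - j') = N"
        if "j' \<le> j" "coeff (coeff f j') i' * coeff (coeff g (j - j')) (i - i') \<noteq> 0" for j'
      proof -
        have "A * i' + B * j' \<le> M" "A * (i - i') + B * (j - j') \<le> N"
          using f g that(2) unfolding weight_le_def by auto
        then show ?thesis using i_eq j_eq[OF that(1)] j by linarith
      qed
      \<comment> \<open>At most one \<open>j'\<close> contributes: the one that puts both factors on their extremal lines.\<close>
      show ?thesis
      proof (cases "\<exists>j'\<le>j. A * i' + B * j' = M")
        case True
        then obtain j0 where j0: "j0 \<le> j" "A * i' + B * j0 = M" by blast
        have "A * (i - i') + B * (j - j0) = N" using j0 i_eq j_eq[OF j0(1)] j by linarith
        then have *: "coeff (edge_poly A B M f) i' * coeff (edge_poly A B N g) (i - i') =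
          coeff (coeff f j0) i' * coeff (coeff g (j - j0)) (i - i')"
          using coeff_edge_poly[OF B] j0 by metis
        have "j' = j0" if "A * i' + B * j' = M" for j'
          using that j0 B by (metis add_left_cancel mult_left_cancel not_gr_zero)
        then have "(\<Sum>j'\<le>j. coeff (coeff f j') i' * coeff (coeff g (j - j')) (i - i')) =
            (\<Sum>j'\<in>{j0}. coeff (coeff f j') i' * coeff (coeff g (j - j')) (i - i'))"
          using j0 edge by (intro sum.mono_neutral_right) blast+
        then show ?thesis using * by simp
      next
        case False
        then have l: "(\<Sum>j'\<le>j. coeff (coeff f j') i' * coeff (coeff g (j - j')) (i - i')) = 0"
          using edge by (intro sum.neutral) blast
        have "coeff (edge_poly A B M f) i' * coeff (edge_poly A B N g) (i - i') = 0"
        proof (rule ccontr)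
          assume "\<not> ?thesis"
          then obtain j1 j2 where j12: "A * i' + B * j1 = M" "A * (i - i') + B * j2 = N"
            by (metis coeff_edge_poly_nz mult_eq_0_iff)
          then have "B * (j1 + j2) = B * j" using i_eq j by (simp add: distrib_left)
          then have "j1 \<le> j" using B by simp
          then show False using False j12 by blast
        qed
        then show ?thesis using l by simp
      qed
    qed
    then have "coeff (edge_poly A B M f * edge_poly A B N g) i = coeff (coeff (f * g) j) i"
      by (simp add: coeff_mult[of "edge_poly A B M f"] coeff_coeff_mult)
    then show ?thesis using coeff_edge_poly[OF B j] by simp
  next
    case False
    have "coeff (edge_poly A B M f) i' * coeff (edge_poly A B N g) (i - i') = 0" if "i' \<le> i" for i'
    proof (rule ccontr)
      assume "\<not> ?thesis"
      then obtain j1 j2 where "A * i' + B * j1 = M" "A * (i - i') + B * j2 = N"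
        by (metis coeff_edge_poly_nz mult_eq_0_iff)
      then have "A * (i' + (i - i')) + B * (j1 + j2) = M + N"
        by (simp only: distrib_left)
      then show False using False that by auto
    qed
    then have "coeff (edge_poly A B M f * edge_poly A B N g) i = 0"
      unfolding coeff_mult by (intro sum.neutral) auto
    then show ?thesis using False coeff_edge_poly_nz by metis
  qed
qed

lemma edge_poly_power:
  assumes "B > 0" and "weight_le A B M f"
  shows "edge_poly A B (m * M) (f ^ m) = edge_poly A B M f ^ m"
proof (induction m)
  case 0
  have "edge_poly A B 0 (1 :: 'a poly poly) = 1"
    using assms by (simp add: edge_poly_def)
  then show ?case by simp
next
  case (Suc m)
  then show ?case
    using edge_poly_mult[OF assms(1,2) weight_le_power[OF assms(2)], of m] by simp
qed

section \<open>Gaps in the powers of a polynomial\<close>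

text \<open>
  The coefficients of \<open>h = p\<^sup>m\<close> satisfy a linear recurrence of order \<open>deg p\<close>: compare the coefficients
  of \<open>x\<^sup>k\<close> in \<open>p (x h') = m (x p') h\<close>.
\<close>
lemma coeff_power_recurrence:
  fixes p :: "'a::field_char_0 poly"
  shows "(\<Sum>i\<le>k. coeff p i * (of_nat (k - i) - of_nat m * of_nat i) * coeff (p ^ m) (k - i)) = 0"
proof (cases m)
  case 0
  then show ?thesis by (auto intro!: sum.neutral simp: coeff_1 split: if_splits)
next
  case (Suc m')
  \<comment> \<open>Multiplying the derivative by \<open>x\<close> makes the coefficient of \<open>x\<^sup>i\<close> a multiple of the old one, without a shift.\<close>
  have xD: "coeff (pCons 0 (pderiv q)) i = of_nat i * coeff q i" for q :: "'a poly" and i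
    by (cases i) (simp_all add: coeff_pderiv)
  have "p * pderiv (p ^ m) = smult (of_nat m) (pderiv p * p ^ m)"
    unfolding Suc pderiv_power_Suc by (simp add: mult.commute mult.left_commute)
  then have "p * pCons 0 (pderiv (p ^ m)) = smult (of_nat m) (pCons 0 (pderiv p) * p ^ m)"
    by simp
  then have "coeff (p * pCons 0 (pderiv (p ^ m))) k = coeff (smult (of_nat m) (pCons 0 (pderiv p) * p ^ m)) k"
    by (rule arg_cong)
  then show ?thesis
    by (simp only: coeff_mult coeff_smult xD sum_distrib_left)
       (simp add: algebra_simps sum_subtractf sum.distrib)
qed

text \<open>
  The recurrence determines each coefficient of \<open>p\<^sup>m\<close> from the \<open>deg p\<close> preceding ones, because the
  coefficient at its leading place is \<open>k p(0)\<close>.  A gap of that length therefore never closes.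
\<close>
lemma coeff_power_eq_0_after_gap:
  fixes p :: "'a::field_char_0 poly"
  assumes p0: "coeff p 0 \<noteq> 0" and K: "K > 0"
    and gap: "\<And>k. K \<le> k \<Longrightarrow> k < K + degree p \<Longrightarrow> coeff (p ^ m) k = 0"
    and k: "K \<le> k"
  shows "coeff (p ^ m) k = 0"
  using k
proof (induction k rule: less_induct)
  case (less k)
  show ?case
  proof (cases "k < K + degree p")
    case True
    then show ?thesis using gap less.prems by blast
  next
    case False
    have "coeff p i * (of_nat (k - i) - of_nat m * of_nat i) * coeff (p ^ m) (k - i) = 0"
      if "i \<le> k" "i \<noteq> 0" for i
    proof (cases "i \<le> degree p")
      case True
      then have "coeff (p ^ m) (k - i) = 0" using less.IH[of "k - i"] False that K by simp
      then show ?thesis by simp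
    next
      case False
      then show ?thesis by (simp add: coeff_eq_0)
    qed
    then have "(\<Sum>i\<le>k. coeff p i * (of_nat (k - i) - of_nat m * of_nat i) * coeff (p ^ m) (k - i)) =
      (\<Sum>i\<in>{0}. coeff p i * (of_nat (k - i) - of_nat m * of_nat i) * coeff (p ^ m) (k - i))"
      by (intro sum.mono_neutral_right) auto
    from this[unfolded coeff_power_recurrence]
    have "coeff p 0 * of_nat k * coeff (p ^ m) k = 0" by simp
    then show ?thesis using p0 K less.prems by simp
  qed
qed

text \<open>
  With \<open>n = deg p\<close>, the hypothesis makes the coefficients of \<open>p\<^sup>m\<close> vanish for \<open>m \<le> k \<le> n m (d - 1) / d\<close>.
  The length of this interval is \<open>m (n d - n - d) / d\<close>, so if \<open>n d > n + d\<close> it eventually contains \<open>n\<close>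
  consecutive integers, and by the preceding lemma the leading coefficient of \<open>p\<^sup>m\<close>
  would vanish.  Equality \<open>n d = n + d\<close> forces \<open>n = d = 2\<close>, where the first two powers suffice.
\<close>
lemma polynomial_power_gap:
  fixes p :: "'a::field_char_0 poly"
  assumes p0: "coeff p 0 \<noteq> 0" and n: "degree p > 0"
    and gap: "\<And>m k. m \<ge> 1 \<Longrightarrow> m \<le> k \<Longrightarrow> d * k \<le> degree p * m * (d - 1) \<Longrightarrow> coeff (p ^ m) k = 0"
  shows "degree p * d < degree p + d"
proof (rule ccontr)
  define n where "n = degree p"
  assume "\<not> ?thesis"
  then have le: "n + d \<le> n * d" by (simp add: n_def)
  have n0: "n > 0" using n by (simp add: n_def)
  obtain d' where d': "d = Suc d'" using le n0 by (cases d) auto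
  have lead: "coeff (p ^ m) (n * m) \<noteq> 0" for m
    using n by (metis coeff_0_degree_minus_1 degree_0 degree_power_eq leading_coeff_neq_0 less_numeral_extra(3) mult.commute n_def power_not_zero)
  show False
  proof (cases "n + d = n * d")
    case True
    then have "n * d' = d' + 1" using d' by simp
    moreover from this have "d' dvd 1" by (metis dvd_add_right_iff dvd_refl dvd_triv_right)
    ultimately have "n = 2" "d = 2" using d' by auto
    have "coeff p 1 = 0" using gap[of 1 1] \<open>n = 2\<close> \<open>d = 2\<close> by (simp add: n_def)
    moreover have "coeff (p ^ 2) 2 = 0" using gap[of 2 2] \<open>n = 2\<close> \<open>d = 2\<close> by (simp add: n_def)
    moreover have "coeff (p ^ 2) 2 = 2 * coeff p 0 * coeff p 2 + coeff p 1 * coeff p 1"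
      by (simp add: power2_eq_square coeff_mult numeral_2_eq_2)
    ultimately have "coeff p 2 = 0" using p0 by simp
    then show False using lead[of 1] \<open>n = 2\<close> by simp
  next
    case False
    \<comment> \<open>The exponent \<open>m = n d\<close> is large enough: the vanishing interval then runs from \<open>n d\<close> to \<open>n\<^sup>2 (d - 1)\<close>.\<close>
    have "coeff (p ^ (n * d)) k = 0" if "n * d \<le> k" for k
    proof (rule coeff_power_eq_0_after_gap[OF p0 _ _ that])
      show "n * d > 0" using n0 d' by simp
      fix k assume k: "n * d \<le> k" "k < n * d + degree p"
      have "n * d + n \<le> n * (n * d') + 1" 
      proof -
        have "d + 1 \<le> n * d'" using le False d' by simp
        then have "n * (d + 1) \<le> n * (n * d')" by (rule mult_le_mono2)
        then show ?thesis by simp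
      qed
      then have "k \<le> n * (n * d')" using k by (simp add: n_def)
      then have "d * k \<le> d * (n * (n * d'))" by (rule mult_le_mono2)
      then have "d * k \<le> degree p * (n * d) * (d - 1)" by (simp add: d' n_def algebra_simps)
      then show "coeff (p ^ (n * d)) k = 0" using gap[of "n * d" k] k n0 d' by simp
    qed
    from this[of "n * (n * d)"] show False using lead[of "n * d"] n0 by simp
  qed
qed

section \<open>Extremal coefficients under iteration of \<open>\<Lambda>\<close>\<close>

definition fdiff :: "(nat \<Rightarrow> 'a::field_char_0) \<Rightarrow> nat \<Rightarrow> 'a" where
  "fdiff g k = g (Suc k) - g k"

lemma newton_forward: "g k = (\<Sum>j\<le>k. of_nat (k choose j) * (fdiff ^^ j) g 0)"
proof (induction k arbitrary: g)
  case 0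
  then show ?case by simp
next
  case (Suc k)
  have shift: "(fdiff ^^ j) (fdiff g) 0 = (fdiff ^^ Suc j) g 0" for j
    by (simp only: funpow_Suc_right o_def)
  have "g (Suc k) = g k + fdiff g k" by (simp add: fdiff_def)
  also have "g k = (\<Sum>j\<le>Suc k. of_nat (k choose j) * (fdiff ^^ j) g 0)"
    using Suc.IH[of g] by (simp add: binomial_eq_0)
  also have "\<dots> = g 0 + (\<Sum>j\<le>k. of_nat (k choose Suc j) * (fdiff ^^ Suc j) g 0)"
    by (subst sum.atMost_Suc_shift) simp
  also have "fdiff g k = (\<Sum>j\<le>k. of_nat (k choose j) * (fdiff ^^ Suc j) g 0)"
    using Suc.IH[of "fdiff g"] by (simp only: shift)
  finally have "g (Suc k) = g 0 + (\<Sum>j\<le>k. of_nat (Suc k choose Suc j) * (fdiff ^^ Suc j) g 0)"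
    by (simp add: sum.distrib algebra_simps del: funpow.simps)
  then show ?case by (subst sum.atMost_Suc_shift) simp
qed

lemma fdiff_funpow_eq_0:
  assumes "\<And>i. i \<le> n \<Longrightarrow> g i = 0"
  shows "(fdiff ^^ n) g 0 = 0"
  using assms
proof (induction n arbitrary: g)
  case (Suc n)
  then show ?case by (simp add: funpow_Suc_right fdiff_def del: funpow.simps)
qed simp

text \<open>
  If the \<open>m\<close>-th differences vanish on an initial segment, all differences of order \<open>m\<close> to \<open>K\<close> vanish at \<open>0\<close>,
  and the first \<open>m\<close> terms of Newton's formula form a polynomial that interpolates \<open>g\<close>.
\<close>
lemma ex_poly_of_fdiff_eq_0:
  assumes m: "m > 0" and g: "\<And>i. i + m \<le> K \<Longrightarrow> (fdiff ^^ m) g i = 0"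
  shows "\<exists>\<pi>. degree \<pi> < m \<and> (\<forall>k\<le>K. poly \<pi> (of_nat k) = g k)"
proof -
  define \<pi> where
    "\<pi> = (\<Sum>j<m. smult ((fdiff ^^ j) g 0 / fact j) (\<Prod>t<j. [:- of_nat t, 1:]))"
  have high: "(fdiff ^^ j) g 0 = 0" if "m \<le> j" "j \<le> K" for j
  proof -
    have "(fdiff ^^ (j - m)) ((fdiff ^^ m) g) 0 = 0"
      by (rule fdiff_funpow_eq_0) (use that g in auto)
    then show ?thesis using that by (simp flip: funpow_add[THEN fun_cong, unfolded o_def])
  qed
  have binom: "poly (\<Prod>t<j. [:- of_nat t, 1:]) (of_nat k) = fact j * (of_nat (k choose j) :: 'a)" for j k
    by (simp add: poly_prod binomial_gbinomial gbinomial_prod_rev atLeast0LessThan)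
  have "degree \<pi> < m" unfolding \<pi>_def
  proof (rule degree_sum_less[OF _ m])
    fix j assume "j \<in> {..<m}"
    have "degree (\<Prod>t<j. [:- of_nat t, 1 :: 'a:]) \<le> (\<Sum>t<j. degree [:- of_nat t, 1 :: 'a:])"
      using degree_prod_sum_le[of "{..<j}" "\<lambda>t. [:- of_nat t, 1 :: 'a:]"] by (simp add: o_def)
    then have "degree (\<Prod>t<j. [:- of_nat t, 1 :: 'a:]) \<le> j" by simp
    then show "degree (smult ((fdiff ^^ j) g 0 / fact j) (\<Prod>t<j. [:- of_nat t, 1:])) < m"
      using \<open>j \<in> {..<m}\<close> by (meson degree_smult_le lessThan_iff order.strict_trans1 order_trans)
  qed
  moreover have "poly \<pi> (of_nat k) = g k" if "k \<le> K" for k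
  proof -
    have "poly \<pi> (of_nat k) = (\<Sum>j<m. of_nat (k choose j) * (fdiff ^^ j) g 0)"
      by (simp add: \<pi>_def poly_sum binom mult.commute)
    also have "\<dots> = (\<Sum>j\<in>{..<m} \<union> {..k}. of_nat (k choose j) * (fdiff ^^ j) g 0)"
      using high that by (intro sum.mono_neutral_left) auto
    also have "\<dots> = (\<Sum>j\<le>k. of_nat (k choose j) * (fdiff ^^ j) g 0)"
      by (intro sum.mono_neutral_right) (auto simp: binomial_eq_0)
    finally show ?thesis using newton_forward[of g k] by simp
  qed
  ultimately show ?thesis by blast
qed

lemma weight_le_Lam_funpow:
  assumes "weight_le A B M f" and "\<forall>l. coeff \<Phi> l \<noteq> 0 \<longrightarrow> A \<le> l * B"
  shows "weight_le A B (M - m * (A + B)) ((Lam \<Phi> ^^ m) f)"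
  unfolding weight_le_dcoeff
proof (intro allI impI)
  fix i j assume "dcoeff ((Lam \<Phi> ^^ m) f) i j \<noteq> 0"
  from weight_drop_Lam_funpow[OF assms this] show "A * i + B * j \<le> M - m * (A + B)" by simp
qed

text \<open>
  For weights with \<open>A < l B\<close> whenever \<open>q\<^sub>l \<noteq> 0\<close>, the terms of \<open>\<Lambda>\<close> other than \<open>\<partial>\<^sub>x\<partial>\<^sub>y\<close> lower the weight by
  more than \<open>A + B\<close>.  On the extremal part, \<open>\<Lambda>\<close> is thus \<open>\<partial>\<^sub>x\<partial>\<^sub>y\<close>.
\<close>
lemma dcoeff_Lam_funpow_steep:
  assumes f: "weight_le A B M f" and \<Phi>: "\<forall>l. coeff \<Phi> l \<noteq> 0 \<longrightarrow> A < l * B"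
    and "A * i + B * j + m * (A + B) = M"
  shows "dcoeff ((Lam \<Phi> ^^ m) f) i j = dcoeff f (i + m) (j + m)"
  using assms(3)
proof (induction m arbitrary: i j)
  case 0
  then show ?case by simp
next
  case (Suc m)
  define h where "h = (Lam \<Phi> ^^ m) f"
  have h: "weight_le A B (M - m * (A + B)) h"
    unfolding h_def using \<Phi> by (intro weight_le_Lam_funpow f) (use less_imp_le in blast)
  have zero: "coeff \<Phi> l * dcoeff h i (Suc (j + l)) = 0" for l
  proof (rule ccontr)
    assume "\<not> ?thesis"
    then have "A < l * B" "A * i + B * Suc (j + l) \<le> M - m * (A + B)"
      using \<Phi> h[unfolded weight_le_dcoeff, rule_format, of i "Suc (j + l)"] by simp_all
    then show False using Suc.prems by (simp add: algebra_simps)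
  qed
  have "dcoeff (Lam \<Phi> h) i j = dcoeff h (Suc i) (Suc j)"
    unfolding dcoeff_Lam zero by simp
  then show ?case using Suc.IH[of "Suc i" "Suc j"] Suc.prems by (simp add: h_def)
qed

text \<open>
  For the weight \<open>r i + j\<close> exactly two terms of \<open>\<Lambda>\<close> lower the weight by the minimal amount \<open>r + 1\<close>, namely
  \<open>\<partial>\<^sub>x\<partial>\<^sub>y\<close> and \<open>- q \<partial>\<^sub>y\<^bsup>r+1\<^esup>\<close> with \<open>q = q\<^sub>r\<close>.  On the extremal coefficients \<open>a\<^sub>k\<close> they act as
  \<open>a\<^sub>k \<mapsto> a\<^bsub>k+1\<^esub> - q a\<^sub>k\<close>; after division by \<open>q\<^sup>k\<close> this is, up to a factor \<open>q\<close>, the forward difference.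
\<close>
lemma dcoeff_Lam_funpow_critical:
  assumes f: "weight_le r 1 M f" and \<Phi>: "\<forall>l<r. coeff \<Phi> l = 0" and q: "coeff \<Phi> r \<noteq> 0"
    and "r * k + m * (r + 1) \<le> M"
  shows "dcoeff ((Lam \<Phi> ^^ m) f) k (M - m * (r + 1) - r * k) =
    coeff \<Phi> r ^ (m + k) * (fdiff ^^ m) (\<lambda>k. dcoeff f k (M - r * k) / coeff \<Phi> r ^ k) k"
  using assms(4)
proof (induction m arbitrary: k)
  case 0
  then show ?case using q by simp
next
  case (Suc m)
  define h where "h = (Lam \<Phi> ^^ m) f"
  define j where "j = M - Suc m * (r + 1) - r * k"
  have j: "r * k + j + Suc m * (r + 1) = M" using Suc.prems by (simp add: j_def)
  have h: "weight_le r 1 (M - m * (r + 1)) h"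
    unfolding h_def by (intro weight_le_Lam_funpow f) (use \<Phi> in \<open>auto simp: not_less[symmetric]\<close>)
  have "coeff \<Phi> l * dcoeff h k (Suc (j + l)) = 0" if "l \<noteq> r" for l
  proof (rule ccontr)
    assume "\<not> ?thesis"
    then have "r \<le> l" "r * k + Suc (j + l) \<le> M - m * (r + 1)"
      using \<Phi> h[unfolded weight_le_dcoeff, rule_format, of k "Suc (j + l)"] by (auto simp: not_less[symmetric])
    then show False using j that by simp
  qed
  then have "(\<Sum>l\<le>degree \<Phi>. coeff \<Phi> l * dcoeff h k (Suc (j + l))) =
     (\<Sum>l\<in>{r}. coeff \<Phi> l * dcoeff h k (Suc (j + l)))"
    using le_degree[OF q] by (intro sum.mono_neutral_right) auto
  then have *: "dcoeff (Lam \<Phi> h) k j = dcoeff h (Suc k) (Suc j) - coeff \<Phi> r * dcoeff h k (Suc (j + r))"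
    by (simp add: dcoeff_Lam)
  have "Suc j = M - m * (r + 1) - r * Suc k" "Suc (j + r) = M - m * (r + 1) - r * k"
    using j by (simp_all add: algebra_simps)
  then show ?case
    using * Suc.IH[of "Suc k"] Suc.IH[of k] Suc.prems
    unfolding h_def[symmetric] j_def[symmetric]
    by (simp add: h_def fdiff_def algebra_simps)
qed

section \<open>Powers whose coefficients are given by factorials\<close>

lemma prod_falling_mult_fact:
  assumes "i \<le> k"
  shows "(\<Prod>t<i. of_nat k - of_nat t) * fact (k - i) = (fact k :: 'a::field_char_0)"
  using assms
proof (induction i)
  case (Suc i)
  have "fact (k - i) = (of_nat k - of_nat i :: 'a) * fact (k - Suc i)"
    using Suc.prems by (simp add: fact_reduce of_nat_diff)
  then show ?case using Suc by (simp add: mult.assoc)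
qed simp

lemma prod_rising_mult_fact:
  assumes "a \<le> b"
  shows "(\<Prod>t\<in>{a<..b}. of_nat (n + t)) * fact (n + a) = (fact (n + b) :: 'a::field_char_0)"
  using assms
proof (induction b rule: dec_induct)
  case (step b)
  have "{a<..Suc b} = insert (Suc b) {a<..b}" using step by auto
  then show ?case using step by (simp add: mult.assoc mult.left_commute)
qed simp

lemma degree_prod_linear_le: "degree (\<Prod>t\<in>T. [:u t, v t:]) \<le> card T"
proof (cases "finite T")
  case True
  have "degree (\<Prod>t\<in>T. [:u t, v t:]) \<le> (\<Sum>t\<in>T. degree [:u t, v t:])"
    using degree_prod_sum_le[OF True, of "\<lambda>t. [:u t, v t:]"] by (simp add: o_def)
  also have "\<dots> \<le> (\<Sum>t\<in>T. 1)" by (intro sum_mono) simp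
  finally show ?thesis by simp
qed simp

text \<open>
  Suppose that the first coefficients of \<open>p\<^sup>m\<close> are \<open>q\<^sup>k \<pi>(k) / (k! (M - r k)!)\<close> with a polynomial \<open>\<pi>\<close>.
  Substitute this into the recurrence for \<open>p\<^sup>m\<close> and multiply by \<open>k! (M - r k + r e)! / q\<^sup>k\<close>, where
  \<open>e = deg p\<close>.  The factorial quotients become polynomials, and the recurrence says that the polynomial
  \<open>F\<^sub>0 + \<dots> + F\<^sub>e\<close> of the proof vanishes at \<open>k\<close>.  The \<open>i\<close>-th summand has degree at most
  \<open>1 + deg \<pi> + i + r (e - i)\<close>, with equality for \<open>i = 0\<close>; as \<open>r \<ge> 2\<close>, the summand \<open>F\<^sub>0\<close>
  dominates strictly and the sum is not zero.  It has \<open>K + 1\<close> roots, more than its degree.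
\<close>
lemma power_coeffs_not_factorial_like:
  fixes p \<pi> :: "'a::field_char_0 poly"
  assumes r: "r \<ge> 2" and p0: "coeff p 0 \<noteq> 0" and q: "q \<noteq> 0"
    and K: "degree \<pi> + 1 + r * degree p \<le> K" and M: "r * K \<le> M"
    and \<pi>: "\<And>k. k \<le> K \<Longrightarrow> fact k * fact (M - r * k) * coeff (p ^ m) k = q ^ k * poly \<pi> (of_nat k)"
  shows False
proof -
  define e where "e = degree p"
  define F where "F i = smult (coeff p i / q ^ i)
     ([:- of_nat (i + m * i), 1:] * (pcompose \<pi> [:- of_nat i, 1:] *
       ((\<Prod>t<i. [:- of_nat t, 1:]) * (\<Prod>t\<in>{r * i<..r * e}. [:of_nat (M + t), - of_nat r:]))))" for i
  have \<pi>0: "\<pi> \<noteq> 0"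
  proof
    assume "\<pi> = 0"
    then have "coeff (p ^ m) 0 = 0" using \<pi>[of 0] by simp
    then show False using p0 by (simp add: coeff_0_power)
  qed
  have "poly (\<Sum>i\<le>e. F i) (of_nat k) = 0" if k: "k \<le> K" for k
  proof -
    define C where "C = (fact k * fact (M - r * k + r * e) / q ^ k :: 'a)"
    define R where "R i = coeff p i * (of_nat (k - i) - of_nat m * of_nat i) * coeff (p ^ m) (k - i)" for i
    have rk: "r * k \<le> M" using M k by (meson mult_le_mono2 order_trans)
    have F_small: "poly (F i) (of_nat k) = R i * C" if i: "i \<le> k" "i \<le> e" for i
    proof -
      have "M - r * (k - i) = M - r * k + r * i" using rk i
        by (simp add: diff_mult_distrib2 mult_le_mono2)
      then have \<pi>i: "poly \<pi> (of_nat k - of_nat i) =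
          fact (k - i) * fact (M - r * k + r * i) * coeff (p ^ m) (k - i) / q ^ (k - i)"
        using \<pi>[of "k - i"] k i q by (simp add: field_simps of_nat_diff)
      have fall: "(\<Prod>t<i. of_nat k - of_nat t) = (fact k / fact (k - i) :: 'a)"
        using prod_falling_mult_fact[OF i(1), where 'a='a] by (simp add: field_simps)
      have "(\<Prod>t\<in>{r * i<..r * e}. of_nat M + of_nat t - of_nat k * of_nat r :: 'a) =
            (\<Prod>t\<in>{r * i<..r * e}. of_nat (M - r * k + t))"
        using rk by (intro prod.cong) (auto simp: of_nat_diff algebra_simps)
      then have rise: "(\<Prod>t\<in>{r * i<..r * e}. of_nat M + of_nat t - of_nat k * of_nat r) =
          (fact (M - r * k + r * e) / fact (M - r * k + r * i) :: 'a)"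
        using prod_rising_mult_fact[of "r * i" "r * e" "M - r * k", where 'a='a] i
        by (simp add: field_simps)
      have "q ^ k = q ^ i * q ^ (k - i)" using i by (simp flip: power_add)
      have "poly (F i) (of_nat k) = coeff p i / q ^ i * ((of_nat k - of_nat i - of_nat m * of_nat i) *
          (poly \<pi> (of_nat k - of_nat i) * ((\<Prod>t<i. of_nat k - of_nat t) *
            (\<Prod>t\<in>{r * i<..r * e}. of_nat M + of_nat t - of_nat k * of_nat r))))"
        by (simp add: F_def poly_prod poly_pcompose algebra_simps)
      also have "\<dots> = R i * C"
        unfolding \<pi>i fall rise R_def C_def of_nat_diff[OF i(1)] \<open>q ^ k = _\<close> using q by simp
      finally show ?thesis .
    qed
    \<comment> \<open>The falling factorial contains the factor \<open>k - k\<close>, which matches the absence of these terms in the recurrence.\<close>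
    have F_large: "poly (F i) (of_nat k) = 0" if "i > k" for i
    proof -
      have "poly (\<Prod>t<i. [:- of_nat t, 1:]) (of_nat k :: 'a) = 0"
        using that by (auto simp: poly_prod)
      then show ?thesis unfolding F_def poly_smult poly_mult by simp
    qed
    have "poly (\<Sum>i\<le>e. F i) (of_nat k) = (\<Sum>i\<le>e. poly (F i) (of_nat k))" by (simp add: poly_sum)
    also have "\<dots> = (\<Sum>i\<in>{..e} \<inter> {..k}. poly (F i) (of_nat k))"
      using F_large by (intro sum.mono_neutral_right) (auto simp: not_le[symmetric])
    also have "\<dots> = (\<Sum>i\<in>{..e} \<inter> {..k}. R i * C)"
      using F_small by (intro sum.cong) auto
    also have "\<dots> = (\<Sum>i\<le>k. R i * C)"
      by (intro sum.mono_neutral_left) (auto simp: R_def e_def coeff_eq_0)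
    also have "\<dots> = 0"
      unfolding R_def sum_distrib_right[symmetric] coeff_power_recurrence by simp
    finally show ?thesis .
  qed
  then have roots: "of_nat ` {..K} \<subseteq> {x. poly (\<Sum>i\<le>e. F i) x = 0}" by auto
  have d0: "degree (F 0) = 1 + (degree \<pi> + r * e)"
  proof -
    define T where "T = (\<Prod>t\<in>{r * 0<..r * e}. [:of_nat (M + t), - of_nat r:] :: 'a poly)"
    have T: "T \<noteq> 0" "degree T = r * e"
      using r by (simp_all add: T_def degree_prod_eq_sum_degree)
    have "F 0 = smult (coeff p 0) (pCons 0 (\<pi> * T))"
      unfolding F_def T_def[symmetric] by simp
    then show ?thesis using p0 \<pi>0 T by (simp add: degree_mult_eq degree_pCons_eq)
  qed
  have di: "degree (F i) < 1 + (degree \<pi> + r * e)" if i: "i \<noteq> 0" "i \<le> e" for i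
  proof -
    have "degree (F i) \<le> 1 + (degree \<pi> + (i + (r * e - r * i)))"
      unfolding F_def
    proof (intro order.trans[OF degree_smult_le] order.trans[OF degree_mult_le] add_mono)
      show "degree [:- of_nat (i + m * i), 1 :: 'a:] \<le> 1" by simp
      show "degree (pcompose \<pi> [:- of_nat i, 1:]) \<le> degree \<pi>"
        using degree_pcompose_le[of \<pi> "[:- of_nat i, 1:]"] by simp
      show "degree (\<Prod>t<i. [:- of_nat t, 1 :: 'a:]) \<le> i"
        using degree_prod_linear_le[of "\<lambda>t. - of_nat t" "\<lambda>t. 1 :: 'a" "{..<i}"] by simp
      show "degree (\<Prod>t\<in>{r * i<..r * e}. [:of_nat (M + t), - of_nat r :: 'a:]) \<le> r * e - r * i"
        using degree_prod_linear_le[of "\<lambda>t. of_nat (M + t)" "\<lambda>t. - of_nat r :: 'a" "{r * i<..r * e}"]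
        by simp
    qed
    moreover have "2 * i \<le> r * i" "r * i \<le> r * e" using r i by (auto intro: mult_le_mono1 mult_le_mono2)
    ultimately show ?thesis using i by linarith
  qed
  have "(\<Sum>i\<le>e. F i) = F 0 + (\<Sum>i\<in>{1..e}. F i)"
    by (simp add: sum.atMost_shift sum.atLeast1_atMost_eq atLeast0LessThan lessThan_Suc_atMost)
  moreover have "degree (\<Sum>i\<in>{1..e}. F i) < degree (F 0)"
  proof (rule degree_sum_less)
    show "degree (F i) < degree (F 0)" if "i \<in> {1..e}" for i
      unfolding d0 using that by (intro di) auto
    show "0 < degree (F 0)" by (simp add: d0)
  qed
  ultimately have deg: "degree (\<Sum>i\<le>e. F i) = 1 + (degree \<pi> + r * e)"
    by (simp add: degree_add_eq_left d0)
  then have "(\<Sum>i\<le>e. F i) \<noteq> 0" by auto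
  from card_mono[OF poly_roots_finite[OF this] roots] card_poly_roots_bound[OF this]
  have "card (of_nat ` {..K} :: 'a set) \<le> 1 + (degree \<pi> + r * e)" unfolding deg by simp
  then show False using K by (simp add: card_image inj_on_def e_def)
qed

section \<open>Shears\<close>

text \<open>
  The automorphism \<open>f(x, y) \<mapsto> f(x, y + c x)\<close>.
\<close>
definition shear :: "'a::field_char_0 \<Rightarrow> 'a poly poly \<Rightarrow> 'a poly poly" where
  "shear c f = pcompose f [:[:0, c:], 1:]"

lemma shear_shear_uminus: "shear c (shear (- c) f) = f"
proof -
  have "pcompose [:[:0, - c:], 1:] [:[:0, c:], 1:] = [:0, 1:]"
    by (simp add: pcompose_pCons)
  then show ?thesis by (simp add: shear_def flip: pcompose_assoc)
qed

lemma shear_mult: "shear c (f * g) = shear c f * shear c g"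
  by (simp add: shear_def pcompose_mult)

lemma shear_power: "shear c (f ^ m) = shear c f ^ m"
  by (induction m) (simp_all add: shear_mult, simp add: shear_def one_pCons)

lemma coeff_dx: "coeff (dx f) j = pderiv (coeff f j)"
  by (simp add: dx_def coeff_map_poly)

lemma dx_add: "dx (f + g) = dx f + dx g"
  by (rule poly_eqI) (simp add: coeff_dx pderiv_add)

lemma dx_pCons: "dx (pCons a f) = pCons (pderiv a) (dx f)"
  by (rule poly_eqI) (simp add: coeff_dx coeff_pCons split: nat.splits)

lemma dx_mult: "dx (f * g) = dx f * g + f * dx g"
  by (rule poly_eqI,
      simp add: coeff_dx coeff_mult higher_pderiv_sum[of 1, simplified] pderiv_mult sum.distrib,
      simp add: mult.commute add.commute)

lemma dy_shear: "dy (shear c f) = shear c (dy f)"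
  by (simp add: dy_def shear_def pderiv_pcompose pderiv_pCons)

lemma dx_shear: "dx (shear c f) = shear c (dx f + smult [:c:] (dy f))"
proof (induction f)
  case 0
  then show ?case by (simp add: shear_def dx_def dy_def)
next
  case (pCons a f)
  define L where "L = [:[:0, c:], 1:]"
  have "dx L = [:[:c:]:]" by (simp add: L_def dx_pCons pderiv_pCons) (simp add: dx_def)
  then show ?case using pCons.IH
    by (simp add: shear_def pcompose_pCons dx_add dx_mult dx_pCons dy_def pderiv_pCons
        pcompose_add pcompose_smult flip: L_def)
       (simp add: dx_def algebra_simps smult_add_right)
qed

lemma Phi_dy_shear: "Phi_dy \<Phi> (shear c f) = shear c (Phi_dy \<Phi> f)"
proof -
  have "(dy ^^ i) (shear c f) = shear c ((dy ^^ i) f)" for i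
    by (induction i) (simp_all add: dy_shear)
  then show ?thesis
    by (simp add: Phi_dy_def) (simp add: shear_def pcompose_sum pcompose_smult)
qed

lemma Phi_dy_diff_linear: "Phi_dy (\<Phi> - [:0, c:]) f = Phi_dy \<Phi> f - smult [:c:] (dy f)"
proof -
  define n where "n = Suc (degree \<Phi>)"
  have extend: "Phi_dy \<Psi> f = (\<Sum>i\<le>n. smult [:coeff \<Psi> i:] ((dy ^^ i) f))" if "degree \<Psi> \<le> n" for \<Psi>
    unfolding Phi_dy_def using that by (intro sum.mono_neutral_left) (auto simp: coeff_eq_0)
  have lin: "coeff [:0, c:] i = (if i = 1 then c else 0)" for i
    by (auto simp: coeff_pCons split: nat.splits)
  have "degree (\<Phi> - [:0, c:]) \<le> n"
    by (rule degree_diff_le) (auto simp: n_def)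
  then have "Phi_dy (\<Phi> - [:0, c:]) f =
      (\<Sum>i\<le>n. smult [:coeff \<Phi> i:] ((dy ^^ i) f) - (if i = 1 then smult [:c:] (dy f) else 0))"
    by (subst extend) (assumption, intro sum.cong refl, simp add: lin flip: smult_diff_left)
  also have "\<dots> = Phi_dy \<Phi> f - smult [:c:] (dy f)"
    by (subst extend[of \<Phi>]) (simp_all add: n_def sum_subtractf)
  finally show ?thesis .
qed

text \<open>
  The chain rule gives \<open>\<partial>\<^sub>x (f(x, y + c x)) = (\<partial>\<^sub>x f + c \<partial>\<^sub>y f)(x, y + c x)\<close>, so the shear turns a linear
  term of \<open>\<Phi>\<close> into part of \<open>\<partial>\<^sub>x\<close>.
\<close>
lemma Lam_shear: "Lam \<Phi> (shear c f) = shear c (Lam (\<Phi> - [:0, c:]) f)"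
  by (simp add: Lam_def dy_shear dx_shear Phi_dy_shear Phi_dy_diff_linear)
     (simp add: shear_def pcompose_diff pcompose_add)

lemma Lam_funpow_shear: "(Lam \<Phi> ^^ m) (shear c f) = shear c ((Lam (\<Phi> - [:0, c:]) ^^ m) f)"
  by (induction m) (simp_all add: Lam_shear)

section \<open>The Newton polygon of \<open>P\<close>\<close>

text \<open>
  When \<open>q\<^sub>0 \<noteq> 0\<close>, the operator \<open>\<partial>\<^sub>x - \<Phi>(\<partial>\<^sub>y)\<close> is injective: it multiplies the monomial that is highest in
  \<open>y\<close>, and then in \<open>x\<close>, by \<open>- q\<^sub>0\<close>.  Hence \<open>\<Lambda> P = 0\<close> means \<open>\<partial>\<^sub>y P = 0\<close>.
\<close>
lemma deg_y_eq_0_of_nonzero_constant_term: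
  assumes q0: "coeff \<Phi> 0 \<noteq> 0" and P: "Lam \<Phi> P = 0"
  shows "degree P = 0"
proof (rule ccontr)
  assume "degree P \<noteq> 0"
  then obtain d where d: "degree P = Suc d" by (cases "degree P") auto
  define i where "i = degree (coeff P (Suc d))"
  have "coeff (coeff P (Suc d)) i \<noteq> 0"
    unfolding i_def using d by (metis leading_coeff_neq_0 degree_0 nat.distinct(1))
  then have nz: "dcoeff P i (Suc d) \<noteq> 0" by (simp add: dcoeff_eq_0_iff)
  have x: "dcoeff P (Suc i) (Suc d) = 0" by (simp add: dcoeff_eq_0_iff i_def coeff_eq_0)
  have y: "dcoeff P i (Suc (d + l)) = 0" if "l \<noteq> 0" for l
    using that d by (simp add: dcoeff_eq_0_iff coeff_eq_0)
  have "(\<Sum>l\<le>degree \<Phi>. coeff \<Phi> l * dcoeff P i (Suc (d + l))) =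
        (\<Sum>l\<in>{0}. coeff \<Phi> l * dcoeff P i (Suc (d + l)))"
    using y by (intro sum.mono_neutral_right) auto
  then have "dcoeff (Lam \<Phi> P) i d = - (coeff \<Phi> 0 * dcoeff P i (Suc d))"
    by (simp add: dcoeff_Lam x)
  then show False using P q0 nz by simp
qed

text \<open>
  In top degree in \<open>y\<close>, only \<open>\<partial>\<^sub>x\<partial>\<^sub>y\<close> contributes to \<open>\<Lambda> P\<close>.
\<close>
lemma leading_coeff_const:
  assumes q0: "coeff \<Phi> 0 = 0" and P: "Lam \<Phi> P = 0" and d: "degree P \<noteq> 0" and i: "i \<noteq> 0"
  shows "coeff (coeff P (degree P)) i = 0"
proof -
  obtain d' where d': "degree P = Suc d'" using d by (cases "degree P") auto
  obtain i' where i': "i = Suc i'" using i by (cases i) auto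
  have zero: "coeff \<Phi> l * dcoeff P i' (Suc (d' + l)) = 0" for l
    using q0 d' by (cases l) (simp_all add: dcoeff_eq_0_iff coeff_eq_0)
  have "dcoeff (Lam \<Phi> P) i' d' = dcoeff P i (degree P)"
    unfolding dcoeff_Lam zero by (simp add: i' d')
  then show ?thesis using P by (simp add: dcoeff_eq_0_iff)
qed

text \<open>
  The monomial \<open>y\<^sup>d\<close> is a vertex of the Newton polygon of \<open>P\<close>.  Follow the edge that leaves it to the
  right, chosen as the one with the least slope \<open>A / B = (d - j) / i\<close>.  If this slope is less than
  \<open>r\<close>, only \<open>\<partial>\<^sub>x\<partial>\<^sub>y\<close> acts on the edge, so the edge part of \<open>P\<^sup>m\<close> has no monomial \<open>x\<^sup>k y\<^sup>j\<close> with
  \<open>k, j \<ge> m\<close>.  For \<open>m = 1\<close> this puts the other end of the edge on the \<open>x\<close>-axis, at \<open>x\<^sup>n\<close> say; for large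
  \<open>m\<close> it gives a gap in the powers of the edge polynomial, whence \<open>n d < n + d\<close>.  All of \<open>P\<close> lies
  below the line through \<open>x\<^sup>n\<close> and \<open>y\<^sup>d\<close>, so the weight \<open>d i + n j\<close>, bounded by \<open>n d\<close>, has the required
  properties.
\<close>
lemma weight_le_of_shallow_edge:
  fixes P :: "'a::field_char_0 poly poly"
  assumes van: "\<And>m. m \<ge> 1 \<Longrightarrow> (Lam \<Phi> ^^ m) (P ^ m) = 0"
    and \<Phi>: "\<forall>l<r. coeff \<Phi> l = 0"
    and d: "degree P = d" "d > 0" and c0: "coeff (coeff P d) 0 \<noteq> 0"
    and top: "\<And>i. i \<noteq> 0 \<Longrightarrow> coeff (coeff P d) i = 0"
    and ex: "\<exists>i j. coeff (coeff P j) i \<noteq> 0 \<and> i \<noteq> 0 \<and> d - j < r * i"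
  shows "\<exists>A B M. weight_le A B M P \<and> M < A + B \<and> (\<forall>l. coeff \<Phi> l \<noteq> 0 \<longrightarrow> A \<le> l * B)"
proof -
  define S where "S = {(i, j). coeff (coeff P j) i \<noteq> 0 \<and> i \<noteq> 0}"
  define slope where "slope = (\<lambda>(i, j). rat_of_nat (d - j) / rat_of_nat i)"
  obtain C where C: "weight_le 1 1 C P" using ex_weight_le by blast
  have "S \<subseteq> {..C} \<times> {..C}" using C unfolding S_def weight_le_def by fastforce
  then have "finite S" by (rule finite_subset) simp
  moreover have "S \<noteq> {}" using ex by (auto simp: S_def)
  ultimately obtain s where s: "s \<in> S" "\<And>t. t \<in> S \<Longrightarrow> slope s \<le> slope t"
    by (metis ex_is_arg_min_if_finite is_arg_min_linorder)
  obtain B j0 where Bj0: "s = (B, j0)" by (cases s)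
  have B: "B > 0" and s_nz: "coeff (coeff P j0) B \<noteq> 0" using s(1) by (auto simp: Bj0 S_def)
  have j0: "j0 < d" using s_nz B top[of B] d(1)
    by (metis coeff_0 coeff_eq_0 linorder_neqE_nat not_gr_zero)
  define A where "A = d - j0"
  have min: "A * i \<le> B * (d - j)" if "coeff (coeff P j) i \<noteq> 0" "i \<noteq> 0" for i j
  proof -
    have "slope (B, j0) \<le> slope (i, j)" using s(2)[of "(i, j)"] that by (simp add: Bj0 S_def)
    then have "rat_of_nat (A * i) \<le> rat_of_nat (B * (d - j))"
      using B that by (simp add: slope_def A_def field_simps)
    then show ?thesis by (simp only: of_nat_le_iff)
  qed
  have wt: "weight_le A B (B * d) P"
    unfolding weight_le_def
  proof (intro allI impI)
    fix i j assume nz: "coeff (coeff P j) i \<noteq> 0"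
    have "j \<le> d" using nz d(1) by (metis coeff_0 le_degree)
    then have "B * d = B * (d - j) + B * j" by (simp flip: distrib_left)
    then show "A * i + B * j \<le> B * d" using min[OF nz] by (cases "i = 0") auto
  qed
  have ArB: "A < r * B"
  proof -
    obtain i j where ij: "coeff (coeff P j) i \<noteq> 0" "i \<noteq> 0" "d - j < r * i" using ex by blast
    have "A * i \<le> B * (d - j)" using min ij by blast
    also have "\<dots> < B * (r * i)" using ij B by simp
    finally show ?thesis using ij by (simp add: mult_ac)
  qed
  have steep: "\<forall>l. coeff \<Phi> l \<noteq> 0 \<longrightarrow> A < l * B"
    using \<Phi> ArB by (meson mult_le_mono1 not_less order_less_le_trans)
  define p where "p = edge_poly A B (B * d) P"
  have p_power: "p ^ m = edge_poly A B (m * (B * d)) (P ^ m)" for m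
    unfolding p_def edge_poly_power[OF B wt] ..
  have p0: "coeff p 0 \<noteq> 0" using c0 coeff_edge_poly[OF B, of A 0 d "B * d" P] by (simp add: p_def)
  have "A * B + B * j0 = B * d"
    using j0 by (simp add: A_def diff_mult_distrib2 mult.commute)
  then have "coeff p B \<noteq> 0" using coeff_edge_poly[OF B, of A B j0 "B * d" P] s_nz by (simp add: p_def)
  then have n: "degree p \<ge> B" by (rule le_degree)
  have zero: "coeff (p ^ m) k = 0"
    if m: "m \<ge> 1" and k: "m \<le> k" and j: "m \<le> j" and eq: "A * k + B * j = m * (B * d)" for m k j
  proof -
    have "A * k = A * (k - m) + A * m" "B * j = B * (j - m) + B * m"
      using k j by (simp_all flip: distrib_left)
    then have "A * (k - m) + B * (j - m) + m * (A + B) = m * (B * d)"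
      using eq by (simp add: algebra_simps)
    from dcoeff_Lam_funpow_steep[OF weight_le_power[OF wt] steep this]
    have "dcoeff (P ^ m) k j = 0" using van[OF m] k j by simp
    then show ?thesis using coeff_edge_poly[OF B eq, of "P ^ m"] by (simp add: p_power dcoeff_eq_0_iff)
  qed
  define n where "n = degree p"
  have nB: "n \<ge> B" "n > 0" using n B by (simp_all add: n_def)
  have An: "A * n = B * d"
  proof -
    have lead: "coeff p n \<noteq> 0" using p0 by (auto simp: n_def)
    then obtain j where j: "A * n + B * j = B * d"
      unfolding p_def by (rule coeff_edge_poly_nz)
    have "j = 0" using zero[of 1 n j] lead j nB by fastforce
    then show ?thesis using j by simp
  qed
  have nd: "n * d < n + d"
    unfolding n_def
  proof (rule polynomial_power_gap[OF p0])
    show "degree p > 0" using nB by (simp add: n_def)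
    fix m k assume m: "m \<ge> 1" and k: "m \<le> k" and dk: "d * k \<le> degree p * m * (d - 1)"
    show "coeff (p ^ m) k = 0"
    proof (rule ccontr)
      assume nz: "coeff (p ^ m) k \<noteq> 0"
      then obtain j where j: "A * k + B * j = m * (B * d)"
        unfolding p_power by (rule coeff_edge_poly_nz)
      have "B * (n * m * (d - 1)) \<ge> B * (d * k)" using dk by (simp add: n_def)
      also have "B * (d * k) = n * (A * k)" using An by (metis mult.assoc mult.commute)
      finally have "n * (A * k) \<le> n * (B * m * (d - 1))" by (simp add: mult_ac)
      then have "A * k \<le> B * m * (d - 1)" using nB by simp
      moreover have "m * (B * d) = B * m * (d - 1) + B * m" using d(2) by (cases d) (simp_all add: algebra_simps)
      ultimately have "B * m \<le> B * j" using j by linarith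
      then have "m \<le> j" using B by simp
      then show False using zero[OF m k _ j] nz by simp
    qed
  qed
  have "weight_le d n (n * d) P"
    unfolding weight_le_def
  proof (intro allI impI)
    fix i j assume "coeff (coeff P j) i \<noteq> 0"
    then have "n * (A * i + B * j) \<le> n * (B * d)" using wt by (simp add: weight_le_def)
    moreover have "n * (A * i + B * j) = B * (d * i + n * j)"
    proof -
      have "n * (A * i + B * j) = (A * n) * i + B * (n * j)" by (simp add: algebra_simps)
      then show ?thesis by (simp add: An algebra_simps)
    qed
    moreover have "n * (B * d) = B * (n * d)" by simp
    ultimately have "B * (d * i + n * j) \<le> B * (n * d)" by metis
    then show "d * i + n * j \<le> n * d" using B by simp
  qed
  moreover have "d \<le> l * n" if "coeff \<Phi> l \<noteq> 0" for l
  proof -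
    have "A * n \<le> l * B * n" using steep that by (simp add: less_imp_le)
    then have "B * d \<le> B * (l * n)" by (simp add: An mult_ac)
    then show ?thesis using B by simp
  qed
  ultimately show ?thesis using nd by (metis add.commute)
qed

lemma four_mult_fact_square_less:
  fixes s :: nat
  assumes "s \<ge> 3"
  shows "4 * s * (fact s * fact s) < (fact (2 * s) :: nat)"
  using assms
proof (induction s rule: dec_induct)
  case base
  show ?case by (simp add: fact_numeral)
next
  case (step s)
  have "4 * Suc s * (fact (Suc s) * fact (Suc s)) = (4 * Suc s * (fact s * fact s)) * (Suc s * Suc s)"
    by (simp only: fact_Suc of_nat_id mult_ac)
  also have "\<dots> \<le> (4 * Suc s * (fact s * fact s)) * (2 * (2 * s + 1) * s)"
  proof (rule mult_le_mono2)
    have "1 \<le> s * s" using step by simp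
    then show "Suc s * Suc s \<le> 2 * (2 * s + 1) * s" by (simp add: algebra_simps)
  qed
  also have "\<dots> = (2 * s + 2) * (2 * s + 1) * (4 * s * (fact s * fact s))"
    by (simp add: algebra_simps)
  also have "\<dots> < (2 * s + 2) * (2 * s + 1) * fact (2 * s)"
    using step.IH by (intro mult_strict_left_mono) auto
  also have "\<dots> = fact (2 * Suc s)"
    by (simp add: algebra_simps)
  finally show ?case .
qed

text \<open>
  Suppose that \<open>d > r\<close>.  On the line \<open>r i + j = d\<close>, which bounds \<open>P\<close> and passes through the vertex \<open>y\<^sup>d\<close>, \<open>\<Lambda>\<^sup>m\<close> acts
  as an \<open>m\<close>-th difference, so the coefficients of the \<open>m\<close>-th power of the edge polynomial, scaled by
  \<open>k! (m d - r k)! / q\<^sup>k\<close>, agree with a polynomial of degree below \<open>m\<close> at all \<open>k \<le> m (d - 1) / r\<close>.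
  For \<open>d \<ge> r + 2\<close> these are enough values for a contradiction with \<open>power_coeffs_not_factorial_like\<close> when \<open>m\<close>
  is large.  For \<open>d = r + 1\<close> there is only one condition for each \<open>m\<close>, but the edge part of \<open>P\<close> is
  \<open>c y\<^bsup>r+1\<^esup> + c\<^sub>1 x y\<close>: the case \<open>m = 1\<close> gives \<open>c\<^sub>1 = q (r + 1)! c\<close>, and \<open>m = 2\<close> then requires
  \<open>(2 r + 2)! = 4 (r + 1) (r + 1)!\<^sup>2\<close>, which is false for \<open>r \<ge> 2\<close>.
\<close>
lemma no_critical_edge:
  fixes P :: "'a::field_char_0 poly poly"
  assumes van: "\<And>m. m \<ge> 1 \<Longrightarrow> (Lam \<Phi> ^^ m) (P ^ m) = 0"
    and r: "r \<ge> 2" and \<Phi>: "\<forall>l<r. coeff \<Phi> l = 0" and q: "coeff \<Phi> r \<noteq> 0"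
    and wt: "weight_le r 1 d P" and c0: "coeff (coeff P d) 0 \<noteq> 0"
  shows "d \<le> r"
proof (rule ccontr)
  assume "\<not> d \<le> r"
  define q where "q = coeff \<Phi> r"
  define p where "p = edge_poly r 1 d P"
  define g where "g m k = dcoeff (P ^ m) k (m * d - r * k) / q ^ k" for m k
  have q0: "q \<noteq> 0" using q by (simp add: q_def)
  have p0: "coeff p 0 \<noteq> 0" using c0 coeff_edge_poly[of 1 r 0 d d P] by (simp add: p_def)
  have p_power: "p ^ m = edge_poly r 1 (m * d) (P ^ m)" for m
    unfolding p_def edge_poly_power[OF zero_less_one wt] ..
  have g: "q ^ k * g m k = fact k * fact (m * d - r * k) * coeff (p ^ m) k" if "r * k \<le> m * d" for m k
    using coeff_edge_poly[of 1 r k "m * d - r * k" "m * d" "P ^ m"] that q0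
    by (simp add: g_def dcoeff_def p_power)
  have diff: "(fdiff ^^ m) (g m) k = 0" if "m \<ge> 1" "r * k + m * (r + 1) \<le> m * d" for m k
    using dcoeff_Lam_funpow_critical[OF weight_le_power[OF wt, of m] \<Phi> q that(2)] van[OF that(1)] q0
    by (simp add: g_def[abs_def] q_def)
  consider "d = r + 1" | "d \<ge> r + 2" using \<open>\<not> d \<le> r\<close> by linarith
  then show False
  proof cases
    case 1
    define c where "c = coeff p 0"
    have p2: "coeff p 2 = 0"
    proof (rule ccontr)
      assume "\<not> ?thesis"
      then obtain j where "r * 2 + 1 * j = d" unfolding p_def by (rule coeff_edge_poly_nz)
      then show False using 1 r by simp
    qed
    have "g 1 1 = g 1 0" using diff[of 1 0] 1 by (simp add: fdiff_def)
    moreover have "g 1 0 = fact (r + 1) * c" using g[of 0 1] 1 by (simp add: c_def)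
    moreover have "q * g 1 1 = coeff p 1" using g[of 1 1] 1 by simp
    ultimately have p1: "coeff p 1 = q * fact (r + 1) * c" by (simp add: mult.assoc)
    have sq: "coeff (p ^ 2) 0 = c * c" "coeff (p ^ 2) 1 = 2 * c * coeff p 1"
        "coeff (p ^ 2) 2 = coeff p 1 * coeff p 1"
      using p2 by (simp_all add: power2_eq_square coeff_mult numeral_2_eq_2 c_def)
    have g20: "g 2 0 = fact (2 * (r + 1)) * (c * c)"
      using g[of 0 2] 1 sq by simp
    have "2 * (r + 1) - r = r + 2" by simp
    then have "q * g 2 1 = fact (r + 2) * (2 * c * coeff p 1)"
      using g[of 1 2] 1 sq by simp
    also have "\<dots> = q * (2 * (fact (r + 2) * fact (r + 1)) * (c * c))"
      unfolding p1 by (simp only: mult_ac)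
    finally have g21: "g 2 1 = 2 * (fact (r + 2) * fact (r + 1)) * (c * c)"
      unfolding mult_left_cancel[OF q0] .
    have "2 * (r + 1) - r * 2 = 2" by simp
    then have "q ^ 2 * g 2 2 = 4 * (coeff p 1 * coeff p 1)"
      using g[of 2 2] 1 sq by (simp add: fact_numeral)
    also have "\<dots> = q ^ 2 * (4 * (fact (r + 1) * fact (r + 1)) * (c * c))"
      unfolding p1 power2_eq_square by (simp only: mult_ac)
    finally have g22: "g 2 2 = 4 * (fact (r + 1) * fact (r + 1)) * (c * c)"
      unfolding mult_left_cancel[OF power_not_zero[OF q0]] .
    have "g 2 2 - 2 * g 2 1 + g 2 0 = 0"
      using diff[of 2 0] 1 by (simp add: fdiff_def numeral_2_eq_2 algebra_simps)
    then have "(4 * (fact (r + 1) * fact (r + 1)) - 4 * (fact (r + 2) * fact (r + 1)) + fact (2 * (r + 1))) * (c * c) = 0"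
      unfolding g20 g21 g22 by (simp add: algebra_simps)
    then have "4 * (fact (r + 1) * fact (r + 1)) - 4 * (fact (r + 2) * fact (r + 1)) + fact (2 * (r + 1)) = (0 :: 'a)"
      using p0 unfolding mult_eq_0_iff c_def by blast
    moreover have "u + w = v" if "u - v + w = 0" for u v w :: 'a
      using that by (simp add: algebra_simps)
    ultimately have "4 * (fact (r + 1) * fact (r + 1)) + fact (2 * (r + 1)) = (4 * (fact (r + 2) * fact (r + 1)) :: 'a)"
      by blast
    then have "of_nat (4 * (fact (r + 1) * fact (r + 1)) + fact (2 * (r + 1))) = (of_nat (4 * (fact (r + 2) * fact (r + 1))) :: 'a)"
      by (simp only: of_nat_add of_nat_mult of_nat_fact of_nat_numeral)
    then have "4 * (fact (r + 1) * fact (r + 1)) + fact (2 * (r + 1)) = (4 * (fact (r + 2) * fact (r + 1)) :: nat)"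
      by (simp only: of_nat_eq_iff)
    also have "fact (r + 2) = (r + 2) * (fact (r + 1) :: nat)"
      by simp
    also have "4 * ((r + 2) * fact (r + 1) * fact (r + 1)) =
        4 * (fact (r + 1) * fact (r + 1)) + 4 * (r + 1) * (fact (r + 1) * fact (r + 1) :: nat)"
      by (simp only: algebra_simps)
    finally show False using four_mult_fact_square_less[of "r + 1"] r by simp
  next
    case 2
    define N where "N = r * degree p + 1"
    \<comment> \<open>A multiple of \<open>r\<close>, so that \<open>K = m (d - 1) / r\<close> is an integer, and large enough for \<open>m + r deg p < K\<close>.\<close>
    define m where "m = r * N"
    define K where "K = N * (d - 1)"
    have N0: "N \<ge> 1" and m0: "m \<ge> 1" using r by (simp_all add: N_def m_def)
    have rK: "r * K + m = m * d" using 2 by (cases d) (simp_all add: K_def m_def algebra_simps)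
    have "N * (r + 1) \<le> K" unfolding K_def using 2 by (intro mult_le_mono2) simp
    then have mK: "m + N \<le> K" by (simp add: m_def mult.commute)
    have "(fdiff ^^ m) (g m) i = 0" if "i + m \<le> K" for i
    proof (rule diff[OF m0])
      have "r * (i + m) \<le> r * K" using that by (rule mult_le_mono2)
      then show "r * i + m * (r + 1) \<le> m * d" using rK by (simp add: algebra_simps)
    qed
    then obtain \<pi> where \<pi>: "degree \<pi> < m" "\<And>k. k \<le> K \<Longrightarrow> poly \<pi> (of_nat k) = g m k"
      using ex_poly_of_fdiff_eq_0[of m K "g m"] m0 by auto
    show False
    proof (rule power_coeffs_not_factorial_like[OF r p0 q0])
      show "degree \<pi> + 1 + r * degree p \<le> K" using \<pi>(1) mK by (simp add: N_def)
      show "r * K \<le> m * d" using rK by simp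
      fix k assume k: "k \<le> K"
      then have "r * k \<le> m * d" using rK by (metis mult_le_mono2 trans_le_add1)
      then show "fact k * fact (m * d - r * k) * coeff (p ^ m) k = q ^ k * poly \<pi> (of_nat k)"
        using g \<pi>(2)[OF k] by metis
    qed
  qed
qed

text \<open>
  If \<open>P\<close> involves \<open>y\<close>, then \<open>q\<^sub>0 = 0\<close> and the leading coefficient in \<open>y\<close> is a constant.  The number \<open>r\<close>
  is the order of \<open>\<Phi>\<close> at \<open>0\<close>; the slope of the edge at \<open>y\<^sup>d\<close> is then compared with \<open>r\<close>.
\<close>
lemma vanishing_without_linear_part:
  fixes P :: "'a::field_char_0 poly poly"
  assumes van: "\<And>m. m \<ge> 1 \<Longrightarrow> (Lam \<Phi> ^^ m) (P ^ m) = 0"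
    and \<Phi>1: "coeff \<Phi> 1 = 0"
  shows "\<exists>A B M. weight_le A B M P \<and> M < A + B \<and> (\<forall>l. coeff \<Phi> l \<noteq> 0 \<longrightarrow> A \<le> l * B)"
proof -
  define d where "d = degree P"
  have LamP: "Lam \<Phi> P = 0" using van[of 1] by simp
  show ?thesis
  proof (cases "d = 0")
    case True
    have "weight_le 0 1 0 P"
      unfolding weight_le_def using True d_def by (metis coeff_0 le_degree mult_0 mult_1 add_0)
    then show ?thesis by (intro exI[of _ 0] exI[of _ 1]) auto
  next
    case False
    then have \<Phi>0: "coeff \<Phi> 0 = 0"
      using deg_y_eq_0_of_nonzero_constant_term[OF _ LamP] by (auto simp: d_def)
    have top: "coeff (coeff P d) i = 0" if "i \<noteq> 0" for i
      using leading_coeff_const[OF \<Phi>0 LamP] False that by (simp add: d_def)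
    have c0: "coeff (coeff P d) 0 \<noteq> 0"
    proof
      assume "coeff (coeff P d) 0 = 0"
      then have "coeff P d = 0" using top by (intro poly_eqI) (metis coeff_0)
      then show False using False by (simp add: d_def)
    qed
    have "\<exists>r\<ge>2. (\<forall>l<r. coeff \<Phi> l = 0) \<and> (coeff \<Phi> r \<noteq> 0 \<or> d \<le> r)"
    proof (cases "\<Phi> = 0")
      case True
      \<comment> \<open>For \<open>\<Phi> = 0\<close> any \<open>r \<ge> d\<close> serves as the order.\<close>
      then show ?thesis by (intro exI[of _ "max 2 d"]) auto
    next
      case False
      then have ex: "\<exists>l. coeff \<Phi> l \<noteq> 0" by (metis leading_coeff_neq_0)
      define r where "r = (LEAST l. coeff \<Phi> l \<noteq> 0)"
      have "coeff \<Phi> r \<noteq> 0" unfolding r_def using ex by (rule LeastI_ex)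
      moreover have "\<forall>l<r. coeff \<Phi> l = 0" unfolding r_def using not_less_Least by blast
      moreover have "r \<noteq> 0" "r \<noteq> 1" using \<Phi>0 \<Phi>1 \<open>coeff \<Phi> r \<noteq> 0\<close> by metis+
      ultimately show ?thesis by (intro exI[of _ r]) auto
    qed
    then obtain r where r: "r \<ge> 2" "\<forall>l<r. coeff \<Phi> l = 0" "coeff \<Phi> r \<noteq> 0 \<or> d \<le> r" by blast
    show ?thesis
    proof (cases "\<exists>i j. coeff (coeff P j) i \<noteq> 0 \<and> i \<noteq> 0 \<and> d - j < r * i")
      case True
      show ?thesis
        by (rule weight_le_of_shallow_edge[OF van r(2) d_def[symmetric] _ c0 top True]) (use False in auto)
    next
      case steep: False
      have wt: "weight_le r 1 d P"
        unfolding weight_le_def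
      proof (intro allI impI)
        fix i j assume nz: "coeff (coeff P j) i \<noteq> 0"
        then have "j \<le> d" unfolding d_def by (metis coeff_0 le_degree)
        moreover have "i = 0 \<or> r * i \<le> d - j" using steep nz by (meson not_less)
        ultimately show "r * i + 1 * j \<le> d" by auto
      qed
      have "d \<le> r" using r(3) no_critical_edge[OF van r(1,2) _ wt c0] by blast
      moreover have "\<forall>l. coeff \<Phi> l \<noteq> 0 \<longrightarrow> r \<le> l * 1" using r(2) by (metis mult_1_right not_less)
      ultimately show ?thesis using wt by (metis le_imp_less_Suc Suc_eq_plus1)
    qed
  qed
qed

theorem theorem2p1:
  fixes \<Phi> :: "'a::field_char_0 poly" and P :: "'a poly poly"
  assumes "\<forall>m\<ge>1. (Lam \<Phi> ^^ m) (P ^ m) = 0"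
  shows "\<forall>Q :: 'a poly poly. \<exists>N. \<forall>m\<ge>N. (Lam \<Phi> ^^ m) (P ^ m * Q) = 0"
proof
  fix Q :: "'a poly poly"
  \<comment> \<open>Shear \<open>P\<close> and \<open>Q\<close> so that the linear coefficient of \<open>\<Phi>\<close> disappears.\<close>
  define c where "c = coeff \<Phi> 1"
  define \<Psi> where "\<Psi> = \<Phi> - [:0, c:]"
  define P' where "P' = shear (- c) P"
  have P: "P = shear c P'" and Q: "Q = shear c (shear (- c) Q)"
    by (simp_all add: P'_def shear_shear_uminus)
  have shear_0: "shear c f = 0 \<longleftrightarrow> f = 0" for c :: 'a and f
    by (simp add: shear_def pcompose_eq_0_iff)
  have "(Lam \<Psi> ^^ m) (P' ^ m) = 0" if "m \<ge> 1" for m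
    using assms that unfolding P by (simp add: Lam_funpow_shear shear_0 \<Psi>_def flip: shear_power)
  moreover have "coeff \<Psi> 1 = 0" by (simp add: \<Psi>_def c_def)
  ultimately obtain A B M where "weight_le A B M P'" "M < A + B" "\<forall>l. coeff \<Psi> l \<noteq> 0 \<longrightarrow> A \<le> l * B"
    using vanishing_without_linear_part by metis
  then obtain N where "\<forall>m\<ge>N. (Lam \<Psi> ^^ m) (P' ^ m * shear (- c) Q) = 0"
    using vanishing_of_weight_less by metis
  then have "(Lam \<Phi> ^^ m) (P ^ m * Q) = 0" if "m \<ge> N" for m
    using that unfolding P by (subst Q)
      (simp add: Lam_funpow_shear shear_0 \<Psi>_def flip: shear_power shear_mult)
  then show "\<exists>N. \<forall>m\<ge>N. (Lam \<Phi> ^^ m) (P ^ m * Q) = 0" by blast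
qed

end
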